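(* For $\theta\in(0,1)$ and $n\in\mathbb{N}$, $$\Theta(1,\theta,n)=2^{1-\theta}.$$ Moreover, $\Theta(1,\theta,n)$ is achieved at $\nu\in\mathcal{M}_1^c(\mathbb{S}^n)$ if and only if $\nu=\frac12\delta_{\xi}+\frac12\delta_{-\xi}$ for some $\xi\in\mathbb{S}^n$.
   Context: $\mathbb{S}^n\subset\mathbb{R}^{n+1}$ is the unit sphere and $\mu$ its standard measure. For $m\in\mathbb{N}$, $\overset{\circ}{\mathcal{P}}_m$ is the set of polynomials $f$ on $\mathbb{R}^{n+1}$ of degree at most $m$ with $\int_{\mathbb{S}^n}f\,d\mu=0$. $\mathcal{M}_m^c(\mathbb{S}^n)$ is the set of probability measures $\nu$ on $\mathbb{S}^n$ supported on countably many (finitely or countably infinitely many) points such that $\int_{\mathbb{S}^n}f\,d\nu=0$ for all $f\in\overset{\circ}{\mathcal{P}}_m$. For $0<\theta<1$, $$\Theta(m,\theta,n)=\inf\left\{\sum_i\nu_i^{\theta}:\nu\in\mathcal{M}_m^c(\mathbb{S}^n)\text{ is supported on the distinct points }\{\xi_i\}\subset\mathbb{S}^n,\ \nu_i=\nu(\{\xi_i\})\right\}.$$ "Achieved at $\nu$" means that $\nu$ attains this infimum. $\delta_\xi$ is the Dirac measure at $\xi$. *)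

theory Defs
  imports "HOL-Probability.Probability"
begin

text \<open>The ambient space \<open>\<real>\<^sup>n\<^sup>+\<^sup>1\<close> is \<^typ>\<open>real ^ 'd\<close> with \<open>CARD('d) = n + 1\<close>,
  so that the sphere \<open>S\<^sup>n\<close> is \<open>sphere 0 1\<close>.\<close>

definition sphere_borel :: "(real ^ 'd::finite) measure" where
  "sphere_borel = restrict_space borel (sphere 0 1)"

text \<open>The surface measure of the sphere, given by the cone construction underlying polar coordinates:
  \<open>\<mu>(A) = (n + 1) \<cdot> vol {r\<xi> | \<xi> \<in> A, 0 < r \<le> 1}\<close>. It is not normalized.\<close>

definition sphere_measure :: "(real ^ 'd::finite) measure" where
  "sphere_measure = scale_measure (of_nat CARD('d))
     (distr (restrict_space lborel (cball 0 1 - {0})) sphere_borel (\<lambda>x. x /\<^sub>R norm x))"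

definition poly_deg_le :: "nat \<Rightarrow> (real ^ 'd::finite \<Rightarrow> real) set" where
  "poly_deg_le m =
     {f. \<exists>c :: ('d \<Rightarrow> nat) \<Rightarrow> real.
           f = (\<lambda>x. \<Sum>\<alpha> | (\<Sum>i\<in>UNIV. \<alpha> i) \<le> m. c \<alpha> * (\<Prod>i\<in>UNIV. (x $ i) ^ \<alpha> i))}"

definition poly_mean_zero :: "nat \<Rightarrow> (real ^ 'd::finite \<Rightarrow> real) set" where
  "poly_mean_zero m = {f \<in> poly_deg_le m. (\<integral>x. f x \<partial>sphere_measure) = 0}"

definition M_c :: "nat \<Rightarrow> (real ^ 'd::finite) measure set" where
  "M_c m =
     {\<nu>. sets \<nu> = sets sphere_borel \<and> prob_space \<nu>
        \<and> (\<exists>X. countable X \<and> X \<subseteq> sphere 0 1 \<and> emeasure \<nu> (sphere 0 1 - X) = 0)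
        \<and> (\<forall>f\<in>poly_mean_zero m. (\<integral>x. f x \<partial>\<nu>) = 0)}"

text \<open>The value is in \<^typ>\<open>ennreal\<close> since the sum over the atoms may diverge.\<close>

definition atom_power_sum :: "real \<Rightarrow> (real ^ 'd::finite) measure \<Rightarrow> ennreal" where
  "atom_power_sum \<theta> \<nu> =
     (\<Sum>\<^sub>\<infinity>\<xi>\<in>{\<xi> \<in> sphere 0 1. measure \<nu> {\<xi>} \<noteq> 0}. ennreal (measure \<nu> {\<xi>} powr \<theta>))"

definition Theta :: "nat \<Rightarrow> real \<Rightarrow> 'd::finite itself \<Rightarrow> ennreal" where
  "Theta m \<theta> _ = (INF \<nu>\<in>(M_c m :: (real ^ 'd) measure set). atom_power_sum \<theta> \<nu>)"

definition Theta_achieved_at :: "nat \<Rightarrow> real \<Rightarrow> (real ^ 'd::finite) measure \<Rightarrow> bool" where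
  "Theta_achieved_at m \<theta> \<nu> \<longleftrightarrow> \<nu> \<in> M_c m \<and> atom_power_sum \<theta> \<nu> = Theta m \<theta> TYPE('d)"

text \<open>Only meaningful if both measures have the same \<open>\<sigma>\<close>-algebra.\<close>

definition add_measure :: "'a measure \<Rightarrow> 'a measure \<Rightarrow> 'a measure" where
  "add_measure M N = measure_of (space M) (sets M) (\<lambda>A. emeasure M A + emeasure N A)"

definition dirac :: "real ^ 'd::finite \<Rightarrow> (real ^ 'd) measure" where
  "dirac \<xi> = return sphere_borel \<xi>"

lemma space_sphere_borel [simp]: "space sphere_borel = sphere 0 1"
  by (simp add: sphere_borel_def space_restrict_space)

lemma sets_sphere_borel_iff:
  "A \<in> sets sphere_borel \<longleftrightarrow> A \<in> sets borel \<and> A \<subseteq> sphere 0 1"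
  by (auto simp: sphere_borel_def sets_restrict_space_iff)

lemma radial_projection_measurable:
  "(\<lambda>x :: real ^ 'd::finite. x /\<^sub>R norm x)
     \<in> measurable (restrict_space lborel (cball 0 1 - {0})) sphere_borel"
  unfolding sphere_borel_def
proof (rule measurable_restrict_space2)
  show "(\<lambda>x :: real ^ 'd. x /\<^sub>R norm x)
          \<in> space (restrict_space lborel (cball 0 1 - {0})) \<rightarrow> sphere 0 1"
    by (auto simp: space_restrict_space)
  show "(\<lambda>x :: real ^ 'd. x /\<^sub>R norm x)
          \<in> measurable (restrict_space lborel (cball 0 1 - {0})) borel"
    by (intro measurable_restrict_space1) simp
qed

lemma emeasure_sphere_measure:
  fixes A :: "(real ^ 'd::finite) set"
  assumes "A \<in> sets sphere_borel"
  shows "emeasure sphere_measure A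
    = of_nat CARD('d) * emeasure lborel {x \<in> cball 0 1 - {0}. x /\<^sub>R norm x \<in> A}"
proof -
  have "(\<lambda>x. x /\<^sub>R norm x) -` A \<inter> space (restrict_space lborel (cball 0 1 - {0}))
      = {x \<in> cball 0 1 - {0}. x /\<^sub>R norm x \<in> A}"
    by (auto simp: space_restrict_space)
  then show ?thesis
    unfolding sphere_measure_def
    by (simp add: emeasure_distr[OF radial_projection_measurable assms])
       (subst emeasure_restrict_space, auto)
qed

lemma finite_multi_indices: "finite {\<alpha> :: 'd::finite \<Rightarrow> nat. (\<Sum>i\<in>UNIV. \<alpha> i) \<le> m}"
proof (rule finite_subset)
  show "{\<alpha> :: 'd \<Rightarrow> nat. (\<Sum>i\<in>UNIV. \<alpha> i) \<le> m} \<subseteq> UNIV \<rightarrow>\<^sub>E {..m}"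
  proof
    fix \<alpha> :: "'d \<Rightarrow> nat"
    assume "\<alpha> \<in> {\<alpha>. (\<Sum>i\<in>UNIV. \<alpha> i) \<le> m}"
    moreover have "\<alpha> i \<le> (\<Sum>i\<in>UNIV. \<alpha> i)" for i
      by (rule member_le_sum) auto
    ultimately show "\<alpha> \<in> UNIV \<rightarrow>\<^sub>E {..m}"
      by (auto intro: order_trans)
  qed
qed (intro finite_PiE, auto)

lemma space_add_measure [simp]: "space (add_measure M N) = space M"
  by (simp add: add_measure_def)

lemma sets_add_measure [simp, measurable_cong]: "sets (add_measure M N) = sets M"
  by (simp add: add_measure_def)

lemma emeasure_add_measure:
  assumes "sets N = sets M" and A: "A \<in> sets M"
  shows "emeasure (add_measure M N) A = emeasure M A + emeasure N A"
proof (rule emeasure_measure_of[OF add_measure_def])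
  show "countably_additive (sets (add_measure M N)) (\<lambda>A. emeasure M A + emeasure N A)"
  proof (rule countably_additiveI)
    fix F :: "nat \<Rightarrow> 'a set"
    assume F: "range F \<subseteq> sets (add_measure M N)" "disjoint_family F"
    then have "range F \<subseteq> sets M" "range F \<subseteq> sets N"
      using assms by auto
    then show "(\<Sum>i. emeasure M (F i) + emeasure N (F i))
        = emeasure M (\<Union>(range F)) + emeasure N (\<Union>(range F))"
      using F(2) by (simp add: suminf_add[symmetric] suminf_emeasure)
  qed
qed (use A in \<open>auto simp: positive_def dest: sets.sets_into_space\<close>)

end

theory Submission
  imports Defs
begin

text \<open>
  A polynomial of degree at most 1 is an affine function \<open>b + a \<bullet> x\<close>. Since \<open>\<mu>\<close> is invariant under
  \<open>x \<mapsto> - x\<close> and has positive finite mass, its \<open>\<mu>\<close>-mean vanishes iff \<open>b = 0\<close>. Hence a countably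
  supported probability measure \<open>\<nu>\<close> on the sphere is admissible for \<open>m = 1\<close> iff \<open>\<integral> a \<bullet> x \<partial>\<nu> = 0\<close> for
  all \<open>a\<close>, that is, iff its barycentre is the origin (\<open>poly_mean_zero_1_iff\<close>).

  For such \<open>\<nu>\<close> and a point \<open>\<xi>\<close> of the sphere, integrating the pointwise inequality
  \<open>0 \<le> 1 + \<xi> \<bullet> x - 2 \<cdot> indicator {\<xi>} x\<close> gives \<open>\<nu> {\<xi>} \<le> 1/2\<close> (\<open>atom_le_half\<close>). If equality holds, the
  integrand vanishes almost everywhere, so \<open>\<nu>\<close> lives on \<open>{\<xi>, - \<xi>}\<close> and is the uniform measure on
  this antipodal pair (\<open>antipodal_pairI\<close>).

  For \<open>0 < t \<le> 1/2\<close> one has \<open>t\<^sup>\<theta> = t \<cdot> t\<^sup>\<theta>\<^sup>-\<^sup>1 \<ge> 2\<^sup>1\<^sup>-\<^sup>\<theta> t\<close>, strictly unless \<open>t = 1/2\<close>. The masses of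
  the atoms sum to 1, so summing this inequality over the atoms yields the lower bound \<open>2\<^sup>1\<^sup>-\<^sup>\<theta>\<close>, and a
  measure attaining it has an atom of mass \<open>1/2\<close> (\<open>minimal_imp_atom_half\<close>). Conversely, the
  uniform measure on an antipodal pair is admissible and has the value \<open>2 \<cdot> (1/2)\<^sup>\<theta> = 2\<^sup>1\<^sup>-\<^sup>\<theta>\<close>.
\<close>

section \<open>Polynomials of degree at most 1\<close>

lemma multi_indices_le_1:
  "{\<alpha> :: 'd::finite \<Rightarrow> nat. (\<Sum>i\<in>UNIV. \<alpha> i) \<le> 1}
     = insert (\<lambda>_. 0) (range (\<lambda>i j. if j = i then 1 else 0))" (is "?L = ?R")
proof
  show "?L \<subseteq> ?R"
  proof
    fix \<alpha> :: "'d \<Rightarrow> nat"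
    assume "\<alpha> \<in> ?L"
    then have le: "(\<Sum>i\<in>UNIV. \<alpha> i) \<le> 1" by simp
    show "\<alpha> \<in> ?R"
    proof (cases "\<exists>i. \<alpha> i \<noteq> 0")
      case True
      then obtain i where i: "\<alpha> i \<noteq> 0" by blast
      have "\<alpha> i + (\<Sum>j\<in>UNIV - {i}. \<alpha> j) \<le> 1"
        using le by (simp add: sum.remove[of UNIV i])
      with i have "\<alpha> i = 1" "(\<Sum>j\<in>UNIV - {i}. \<alpha> j) = 0" by linarith+
      then have "\<alpha> = (\<lambda>j. if j = i then 1 else 0)" by (auto simp: fun_eq_iff)
      then show ?thesis by blast
    qed (auto simp: fun_eq_iff)
  qed
  show "?R \<subseteq> ?L" by auto
qed

lemma poly_deg_le_1_iff:
  fixes f :: "real ^ 'd::finite \<Rightarrow> real"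
  shows "f \<in> poly_deg_le 1 \<longleftrightarrow> (\<exists>a b. f = (\<lambda>x. b + a \<bullet> x))"
proof -
  \<comment> \<open>\<open>u i\<close> is the exponent vector of the monomial \<open>x $ i\<close>.\<close>
  define u :: "'d \<Rightarrow> 'd \<Rightarrow> nat" where "u i = (\<lambda>j. if j = i then 1 else 0)" for i
  have indices: "{\<alpha> :: 'd \<Rightarrow> nat. (\<Sum>i\<in>UNIV. \<alpha> i) \<le> 1} = insert (\<lambda>_. 0) (range u)"
    unfolding multi_indices_le_1 u_def ..
  have inj: "inj u"
    by (rule injI) (metis u_def zero_neq_one)
  have u_nonzero: "u i \<noteq> (\<lambda>_. 0)" for i
    by (metis u_def zero_neq_one)
  have monomial: "(\<Prod>i\<in>UNIV. (x $ i) ^ u k i) = x $ k" for x :: "real ^ 'd" and k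
  proof -
    have "(\<Prod>i\<in>UNIV. (x $ i) ^ u k i) = (\<Prod>i\<in>UNIV. if i = k then x $ i else 1)"
      by (rule prod.cong) (auto simp: u_def)
    then show ?thesis by simp
  qed
  have expand: "(\<Sum>\<alpha> | (\<Sum>i\<in>UNIV. \<alpha> i) \<le> 1. c \<alpha> * (\<Prod>i\<in>UNIV. (x $ i) ^ \<alpha> i))
      = c (\<lambda>_. 0) + (\<chi> i. c (u i)) \<bullet> x"
    for c :: "('d \<Rightarrow> nat) \<Rightarrow> real" and x
  proof -
    have "(\<lambda>_. 0) \<notin> range u"
      using u_nonzero by (metis rangeE)
    then have "(\<Sum>\<alpha> | (\<Sum>i\<in>UNIV. \<alpha> i) \<le> 1. c \<alpha> * (\<Prod>i\<in>UNIV. (x $ i) ^ \<alpha> i))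
        = c (\<lambda>_. 0) + (\<Sum>\<alpha>\<in>range u. c \<alpha> * (\<Prod>i\<in>UNIV. (x $ i) ^ \<alpha> i))"
      unfolding indices by simp
    also have "(\<Sum>\<alpha>\<in>range u. c \<alpha> * (\<Prod>i\<in>UNIV. (x $ i) ^ \<alpha> i)) = (\<Sum>k\<in>UNIV. c (u k) * x $ k)"
      unfolding sum.reindex[OF inj] comp_def monomial ..
    finally show ?thesis
      by (simp add: inner_vec_def)
  qed
  show ?thesis
  proof
    assume "f \<in> poly_deg_le 1"
    then show "\<exists>a b. f = (\<lambda>x. b + a \<bullet> x)"
      unfolding poly_deg_le_def expand by blast
  next
    assume "\<exists>a b. f = (\<lambda>x. b + a \<bullet> x)"
    then obtain a b where f: "f = (\<lambda>x. b + a \<bullet> x)" by blast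
    define c :: "('d \<Rightarrow> nat) \<Rightarrow> real"
      where "c \<alpha> = (if \<alpha> = (\<lambda>_. 0) then b else a $ inv u \<alpha>)" for \<alpha>
    have "c (\<lambda>_. 0) = b" by (simp add: c_def)
    moreover have "(\<chi> i. c (u i)) = a"
      by (simp add: c_def u_nonzero inv_f_f[OF inj] vec_eq_iff)
    ultimately have "f = (\<lambda>x. \<Sum>\<alpha> | (\<Sum>i\<in>UNIV. \<alpha> i) \<le> 1. c \<alpha> * (\<Prod>i\<in>UNIV. (x $ i) ^ \<alpha> i))"
      unfolding expand by (simp only: f)
    then show "f \<in> poly_deg_le 1"
      unfolding poly_deg_le_def by blast
  qed
qed

section \<open>Antipodal symmetry of the surface measure\<close>

lemma borel_measurable_sphere:
  assumes "sets M = sets (sphere_borel :: (real ^ 'd::finite) measure)"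
    and "f \<in> borel_measurable borel"
  shows "f \<in> borel_measurable M"
proof -
  have "f \<in> borel_measurable sphere_borel"
    unfolding sphere_borel_def by (rule measurable_restrict_space1) (rule assms(2))
  then show ?thesis
    using measurable_cong_sets[OF assms(1) refl] by blast
qed

lemma sets_sphere_measure: "sets sphere_measure = sets sphere_borel"
  by (simp add: sphere_measure_def)

lemma space_sphere_measure: "space sphere_measure = sphere 0 1"
  by (metis sets_eq_imp_space_eq sets_sphere_measure space_sphere_borel)

lemma lborel_distr_uminus_euclidean:
  "distr lborel borel uminus = (lborel :: 'a::euclidean_space measure)"
  by (subst lborel_affine[of "-1" 0])
     (auto simp: density_1 one_ennreal_def[symmetric])

lemma emeasure_lborel_uminus:
  fixes A :: "'a::euclidean_space set"
  assumes "A \<in> sets borel"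
  shows "emeasure lborel (uminus -` A) = emeasure lborel A"
proof -
  have "emeasure (distr lborel borel uminus) A = emeasure lborel (uminus -` A)"
    using assms by (subst emeasure_distr) auto
  then show ?thesis
    by (simp add: lborel_distr_uminus_euclidean)
qed

lemma uminus_measurable_sphere_borel:
  "uminus \<in> measurable sphere_borel (sphere_borel :: (real ^ 'd::finite) measure)"
  unfolding sphere_borel_def
  by (rule measurable_restrict_space3) auto

lemma distr_sphere_measure_uminus:
  "distr sphere_measure sphere_borel uminus = (sphere_measure :: (real ^ 'd::finite) measure)"
proof (rule measure_eqI)
  show "sets (distr sphere_measure sphere_borel uminus) = sets (sphere_measure :: (real ^ 'd) measure)"
    by (simp add: sets_sphere_measure)
  fix A :: "(real ^ 'd) set"
  assume "A \<in> sets (distr sphere_measure sphere_borel uminus)"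
  then have A: "A \<in> sets sphere_borel" by simp
  have um: "uminus \<in> measurable sphere_measure (sphere_borel :: (real ^ 'd) measure)"
    using uminus_measurable_sphere_borel measurable_cong_sets[OF sets_sphere_measure refl] by blast
  let ?C = "\<lambda>A. {x \<in> cball 0 1 - {0}. x /\<^sub>R norm x \<in> A} :: (real ^ 'd) set"
  \<comment> \<open>\<open>?C A\<close> is the cone over \<open>A\<close>, whose Lebesgue measure defines the surface measure of \<open>A\<close>.\<close>
  have cone: "?C A \<in> sets borel"
  proof -
    have "(\<lambda>x. x /\<^sub>R norm x) -` A \<inter> space (restrict_space lborel (cball 0 1 - {0}))
        \<in> sets (restrict_space lborel (cball 0 1 - {0}))"
      by (rule measurable_sets[OF radial_projection_measurable A])
    moreover have "(\<lambda>x. x /\<^sub>R norm x) -` A \<inter> space (restrict_space lborel (cball 0 1 - {0})) = ?C A"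
      by (auto simp: space_restrict_space)
    ultimately show ?thesis
      by (subst (asm) sets_restrict_space_iff) auto
  qed
  have neg: "uminus -` A \<in> sets sphere_borel"
  proof -
    have "uminus -` A = uminus -` A \<inter> space sphere_borel"
      using A by (auto simp: sets_sphere_borel_iff)
    then show ?thesis
      using measurable_sets[OF uminus_measurable_sphere_borel A] by simp
  qed
  have "emeasure (distr sphere_measure sphere_borel uminus) A = emeasure sphere_measure (uminus -` A)"
  proof -
    have "uminus -` A \<inter> space sphere_measure = uminus -` A"
      using neg by (auto simp: space_sphere_measure sets_sphere_borel_iff)
    then show ?thesis
      by (simp only: emeasure_distr[OF um A])
  qed
  also have "\<dots> = of_nat CARD('d) * emeasure lborel (?C (uminus -` A))"
    by (rule emeasure_sphere_measure[OF neg])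
  also have "?C (uminus -` A) = uminus -` ?C A" by auto
  also have "emeasure lborel (uminus -` ?C A) = emeasure lborel (?C A)"
    by (rule emeasure_lborel_uminus[OF cone])
  also have "of_nat CARD('d) * emeasure lborel (?C A) = emeasure sphere_measure A"
    by (rule emeasure_sphere_measure[OF A, symmetric])
  finally show "emeasure (distr sphere_measure sphere_borel uminus) A = emeasure sphere_measure A" .
qed

lemma emeasure_sphere_measure_sphere:
  "emeasure (sphere_measure :: (real ^ 'd::finite) measure) (sphere 0 1)
     = of_nat CARD('d) * emeasure lborel (cball (0 :: real ^ 'd) 1)"
proof -
  have S: "sphere 0 1 \<in> sets (sphere_borel :: (real ^ 'd) measure)"
    using sets.top[of sphere_borel] by simp
  have C: "{x \<in> cball 0 1 - {0}. x /\<^sub>R norm x \<in> sphere 0 1} = cball (0 :: real ^ 'd) 1 - {0}"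
    by auto
  have "emeasure lborel (cball (0 :: real ^ 'd) 1 - {0}) = emeasure lborel (cball (0 :: real ^ 'd) 1)"
    by (rule emeasure_Diff_null_set) (auto simp: null_sets_def)
  then show ?thesis
    unfolding emeasure_sphere_measure[OF S] C by simp
qed

lemma finite_sphere_measure: "finite_measure (sphere_measure :: (real ^ 'd::finite) measure)"
  using emeasure_lborel_cball_finite[of "0 :: real ^ 'd" 1]
  by (intro finite_measureI)
     (simp add: space_sphere_measure emeasure_sphere_measure_sphere ennreal_mult_eq_top_iff)

lemma measure_sphere_measure_pos:
  "measure (sphere_measure :: (real ^ 'd::finite) measure) (sphere 0 1) > 0"
proof -
  have "measure lborel (cball (0 :: real ^ 'd) 1) > 0"
    using content_cball_pos[of 1 "0 :: real ^ 'd"] by simp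
  then show ?thesis
    by (simp add: measure_def emeasure_sphere_measure_sphere enn2real_mult)
qed

section \<open>Mean values of affine functions\<close>

lemma integral_sphere_measure_affine:
  fixes a :: "real ^ 'd::finite"
  shows "(\<integral>x. b + a \<bullet> x \<partial>sphere_measure) = b * measure (sphere_measure :: (real ^ 'd) measure) (sphere 0 1)"
proof -
  interpret finite_measure "sphere_measure :: (real ^ 'd) measure"
    by (rule finite_sphere_measure)
  have meas: "(\<lambda>x. a \<bullet> x) \<in> borel_measurable sphere_measure"
    by (rule borel_measurable_sphere[OF sets_sphere_measure]) simp
  have int: "integrable sphere_measure (\<lambda>x. a \<bullet> x)"
  proof (rule integrable_const_bound[where B="norm a"])
    show "AE x in sphere_measure. norm (a \<bullet> x) \<le> norm a"
      using Cauchy_Schwarz_ineq2[of a]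
      by (intro AE_I2) (simp add: space_sphere_measure, metis mult.right_neutral)
  qed (rule meas)
  have "(\<integral>x. a \<bullet> x \<partial>sphere_measure) = (\<integral>x. a \<bullet> x \<partial>distr sphere_measure sphere_borel uminus)"
    by (simp add: distr_sphere_measure_uminus)
  also have "\<dots> = (\<integral>x. a \<bullet> (- x) \<partial>sphere_measure)"
  proof (rule integral_distr)
    show "uminus \<in> measurable sphere_measure (sphere_borel :: (real ^ 'd) measure)"
      using uminus_measurable_sphere_borel measurable_cong_sets[OF sets_sphere_measure refl] by blast
    show "(\<lambda>x. a \<bullet> x) \<in> borel_measurable sphere_borel"
      by (rule borel_measurable_sphere) simp_all
  qed
  finally have "(\<integral>x. a \<bullet> x \<partial>sphere_measure) = 0" by simp
  then show ?thesis
    using int by (simp add: space_sphere_measure)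
qed

text \<open>The barycentre characterisation: the test functions for \<open>m = 1\<close> are exactly the linear forms.\<close>

lemma poly_mean_zero_1_iff:
  fixes f :: "real ^ 'd::finite \<Rightarrow> real"
  shows "f \<in> poly_mean_zero 1 \<longleftrightarrow> (\<exists>a. f = (\<lambda>x. a \<bullet> x))"
proof
  assume f: "f \<in> poly_mean_zero 1"
  then obtain a b where ab: "f = (\<lambda>x. b + a \<bullet> x)"
    unfolding poly_mean_zero_def poly_deg_le_1_iff by blast
  with f have "b * measure (sphere_measure :: (real ^ 'd) measure) (sphere 0 1) = 0"
    by (simp add: poly_mean_zero_def integral_sphere_measure_affine)
  then have "b = 0"
    using measure_sphere_measure_pos[where 'd='d] by auto
  with ab show "\<exists>a. f = (\<lambda>x. a \<bullet> x)" by auto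
next
  assume "\<exists>a. f = (\<lambda>x. a \<bullet> x)"
  then obtain a where a: "f = (\<lambda>x. 0 + a \<bullet> x)" by auto
  then have "f \<in> poly_deg_le 1"
    unfolding poly_deg_le_1_iff by blast
  then show "f \<in> poly_mean_zero 1"
    using integral_sphere_measure_affine[of 0 a] a by (simp add: poly_mean_zero_def)
qed

section \<open>Atoms of a centred measure\<close>

lemma infsum_ennreal_eq_nn_integral_count_space:
  fixes f :: "'a \<Rightarrow> ennreal"
  assumes "countable A"
  shows "infsum f A = (\<integral>\<^sup>+x. f x \<partial>count_space A)"
proof (rule antisym)
  have fin: "sum f F = (\<integral>\<^sup>+x. f x * indicator F x \<partial>count_space A)" if "finite F" "F \<subseteq> A" for F
    using that by (subst nn_integral_count_space'[of F]) (auto intro!: sum.cong)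
  show "infsum f A \<le> (\<integral>\<^sup>+x. f x \<partial>count_space A)"
    unfolding nonneg_infsum_complete[of A f, OF zero_le]
    by (intro SUP_least) (auto simp: fin indicator_def intro!: nn_integral_mono)
  show "(\<integral>\<^sup>+x. f x \<partial>count_space A) \<le> infsum f A"
  proof (cases "finite A")
    case True
    then show ?thesis by (simp add: nn_integral_count_space_finite)
  next
    case False
    let ?g = "from_nat_into A"
    have bij: "bij_betw ?g UNIV A"
      by (rule bij_betw_from_nat_into[OF assms False])
    have "(\<integral>\<^sup>+x. f x \<partial>count_space A) = (\<integral>\<^sup>+k. f (?g k) \<partial>count_space UNIV)"
      by (rule nn_integral_bij_count_space[OF bij, symmetric])
    also have "\<dots> = (\<Sum>k. f (?g k))"
      by (rule nn_integral_count_space_nat)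
    also have "\<dots> = (SUP k. \<Sum>i<k. f (?g i))"
      by (rule suminf_eq_SUP)
    also have "\<dots> \<le> infsum f A"
    proof (rule SUP_least)
      fix k :: nat
      have "(\<Sum>i<k. f (?g i)) = sum f (?g ` {..<k})"
        using bij by (subst sum.reindex) (auto simp: bij_betw_def intro: inj_on_subset)
      also have "\<dots> \<le> infsum f A"
        using bij unfolding nonneg_infsum_complete[of A f, OF zero_le]
        by (intro SUP_upper) (auto simp: bij_betw_def)
      finally show "(\<Sum>i<k. f (?g i)) \<le> infsum f A" .
    qed
    finally show ?thesis .
  qed
qed

lemma two_powr_mult_less:
  assumes "0 < t" "t < 1 / 2" "\<theta> < (1::real)"
  shows "2 powr (1 - \<theta>) * t < t powr \<theta>"
proof -
  have "(1 / 2) powr (\<theta> - 1) < t powr (\<theta> - 1)"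
    using assms by (intro powr_less_mono2_neg) auto
  moreover have "(1 / 2 :: real) powr (\<theta> - 1) = 2 powr (1 - \<theta>)"
    by (simp add: powr_divide powr_minus_divide[symmetric])
  moreover have "t powr \<theta> = t powr (\<theta> - 1) * t"
    using assms by (simp add: powr_diff)
  ultimately show ?thesis
    using assms by simp
qed

lemma two_powr_mult_le:
  assumes "0 < t" "t \<le> 1 / 2" "\<theta> < (1::real)"
  shows "2 powr (1 - \<theta>) * t \<le> t powr \<theta>"
proof (cases "t = 1 / 2")
  case True
  then show ?thesis unfolding True by (simp add: powr_diff powr_divide)
qed (use assms two_powr_mult_less[of t \<theta>] in simp)

text \<open>A countably supported probability measure on the sphere with barycentre 0. Membership in
  \<^term>\<open>M_c 1\<close> includes that \<open>\<nu>\<close> is a probability measure; \<^locale>\<open>prob_space\<close> is listed as a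
  parent only to make its facts available.\<close>

locale centred_measure = prob_space \<nu> for \<nu> :: "(real ^ 'd::finite) measure" +
  assumes in_M_c: "\<nu> \<in> M_c 1"
begin

lemma sets_eq: "sets \<nu> = sets sphere_borel"
  using in_M_c by (simp add: M_c_def)

lemma space_eq: "space \<nu> = sphere 0 1"
  by (metis sets_eq_imp_space_eq sets_eq space_sphere_borel)

lemma integral_inner: "(\<integral>x. a \<bullet> x \<partial>\<nu>) = 0"
  using in_M_c poly_mean_zero_1_iff[of "\<lambda>x. a \<bullet> x"] by (auto simp: M_c_def)

lemma singleton_sets: "\<xi> \<in> sphere 0 1 \<Longrightarrow> {\<xi>} \<in> sets \<nu>"
  by (simp add: sets_eq sets_sphere_borel_iff)

text \<open>The inequality behind the bound on the atoms: it is an equality at \<open>x = \<xi>\<close>, and elsewhere it is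
  \<open>- 1 \<le> \<xi> \<bullet> x\<close>, with equality only at \<open>x = - \<xi>\<close>.\<close>

lemma deficit_nonneg:
  fixes \<xi> x :: "real ^ 'd"
  assumes "\<xi> \<in> sphere 0 1" "x \<in> sphere 0 1"
  shows "0 \<le> 1 + \<xi> \<bullet> x - 2 * indicator {\<xi>} x"
proof (cases "x = \<xi>")
  case True
  then show ?thesis using assms by (simp add: dot_square_norm)
next
  case False
  then show ?thesis
    using Cauchy_Schwarz_ineq2[of \<xi> x] assms by simp
qed

lemma deficit:
  assumes "\<xi> \<in> sphere 0 1"
  shows "integrable \<nu> (\<lambda>x. 1 + \<xi> \<bullet> x - 2 * indicator {\<xi>} x)"
    and "(\<integral>x. 1 + \<xi> \<bullet> x - 2 * indicator {\<xi>} x \<partial>\<nu>) = 1 - 2 * measure \<nu> {\<xi>}"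
proof -
  have meas: "(\<lambda>x. \<xi> \<bullet> x) \<in> borel_measurable \<nu>"
    by (rule borel_measurable_sphere[OF sets_eq]) simp
  have int: "integrable \<nu> (\<lambda>x. \<xi> \<bullet> x)"
  proof (rule integrable_const_bound[where B="1"])
    show "AE x in \<nu>. norm (\<xi> \<bullet> x) \<le> 1"
    proof (rule AE_I2)
      fix x assume "x \<in> space \<nu>"
      then have "norm x = 1" by (simp add: space_eq)
      then show "norm (\<xi> \<bullet> x) \<le> 1"
        using Cauchy_Schwarz_ineq2[of \<xi> x] assms by simp
    qed
  qed (rule meas)
  have ind: "integrable \<nu> (indicator {\<xi>} :: _ \<Rightarrow> real)"
    using singleton_sets[OF assms] by (simp add: emeasure_eq_measure)
  show "integrable \<nu> (\<lambda>x. 1 + \<xi> \<bullet> x - 2 * indicator {\<xi>} x)"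
    using int ind by simp
  show "(\<integral>x. 1 + \<xi> \<bullet> x - 2 * indicator {\<xi>} x \<partial>\<nu>) = 1 - 2 * measure \<nu> {\<xi>}"
  proof -
    have "(\<integral>x. indicator {\<xi>} x \<partial>\<nu>) = measure \<nu> {\<xi>}"
      using assms by (simp add: space_eq)
    then show ?thesis
      using int ind by (simp add: integral_inner prob_space)
  qed
qed

lemma atom_le_half:
  assumes "\<xi> \<in> sphere 0 1"
  shows "measure \<nu> {\<xi>} \<le> 1 / 2"
proof -
  have "0 \<le> (\<integral>x. 1 + \<xi> \<bullet> x - 2 * indicator {\<xi>} x \<partial>\<nu>)"
    by (intro integral_nonneg_AE AE_I2) (rule deficit_nonneg[OF assms], simp only: space_eq)
  then show ?thesis
    by (simp add: deficit(2)[OF assms])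
qed

lemma atom_half_imp_antipodal:
  assumes \<xi>: "\<xi> \<in> sphere 0 1" and half: "measure \<nu> {\<xi>} = 1 / 2"
  shows "AE x in \<nu>. x = \<xi> \<or> x = - \<xi>"
proof -
  have "AE x in \<nu>. 1 + \<xi> \<bullet> x - 2 * indicator {\<xi>} x = 0"
  proof (subst integral_nonneg_eq_0_iff_AE[symmetric, OF deficit(1)[OF \<xi>]])
    show "AE x in \<nu>. 0 \<le> 1 + \<xi> \<bullet> x - 2 * indicator {\<xi>} x"
      by (rule AE_I2) (rule deficit_nonneg[OF \<xi>], simp only: space_eq)
    show "(\<integral>x. 1 + \<xi> \<bullet> x - 2 * indicator {\<xi>} x \<partial>\<nu>) = 0"
      unfolding deficit(2)[OF \<xi>] half by simp
  qed
  then show ?thesis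
  proof (rule AE_mp, intro AE_I2 impI)
    fix x
    assume "x \<in> space \<nu>" and zero: "1 + \<xi> \<bullet> x - 2 * indicator {\<xi>} x = 0"
    then have x: "norm x = 1" by (simp add: space_eq)
    have "x = - \<xi>" if "x \<noteq> \<xi>"
    proof -
      have "\<xi> \<bullet> x = - 1" using zero that by simp
      then have "(norm (\<xi> + x))\<^sup>2 = 0"
        using x \<xi> dot_norm[of \<xi> x] by simp
      then show ?thesis by (simp add: add_eq_0_iff)
    qed
    then show "x = \<xi> \<or> x = - \<xi>" by blast
  qed
qed

text \<open>The atoms of \<open>\<nu>\<close>, which form the index set of the sum in \<^const>\<open>atom_power_sum\<close>.\<close>

definition atoms :: "(real ^ 'd) set" where
  "atoms = {\<xi> \<in> sphere 0 1. measure \<nu> {\<xi>} \<noteq> 0}"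

lemma countable_atoms: "countable atoms"
  using countable_support unfolding atoms_def by (rule countable_subset[rotated]) auto

lemma countable_imp_sets:
  assumes "countable B" "B \<subseteq> sphere 0 1"
  shows "B \<in> sets \<nu>"
  by (rule sets.countable[OF _ assms(1)]) (use assms(2) singleton_sets in blast)

lemma atoms_subset: "atoms \<subseteq> sphere 0 1"
  by (auto simp: atoms_def)

lemma sets_atoms:
  assumes "B \<subseteq> atoms"
  shows "B \<in> sets \<nu>"
  using countable_subset[OF assms countable_atoms] order_trans[OF assms atoms_subset]
  by (rule countable_imp_sets)

lemma measure_atoms: "measure \<nu> atoms = 1"
proof -
  obtain X where X: "countable X" "X \<subseteq> sphere 0 1" "emeasure \<nu> (sphere 0 1 - X) = 0"
    using in_M_c unfolding M_c_def by blast
  have sets_X: "X \<in> sets \<nu>"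
    using X(1,2) by (rule countable_imp_sets)
  have "{\<xi>} \<in> null_sets \<nu>" if "\<xi> \<in> X - atoms" for \<xi>
  proof -
    have "\<xi> \<in> sphere 0 1" "measure \<nu> {\<xi>} = 0"
      using that X(2) by (auto simp: atoms_def)
    then show ?thesis
      using singleton_sets by (auto simp: null_sets_def emeasure_eq_measure)
  qed
  then have "(\<Union>\<xi>\<in>X - atoms. {\<xi>}) \<in> null_sets \<nu>"
    using X(1) by (intro null_sets_UN') auto
  then have "AE x in \<nu>. x \<notin> X - atoms"
    by (intro AE_not_in) simp
  moreover have "AE x in \<nu>. x \<notin> sphere 0 1 - X"
  proof (rule AE_not_in)
    have "space \<nu> - X \<in> sets \<nu>" using sets_X by (rule sets.compl_sets)
    then show "sphere 0 1 - X \<in> null_sets \<nu>"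
      using X(3) by (simp add: null_sets_def space_eq)
  qed
  moreover have "AE x in \<nu>. x \<in> sphere 0 1"
    by (rule AE_I2) (simp only: space_eq)
  ultimately have "AE x in \<nu>. x \<in> atoms"
    by eventually_elim blast
  then show ?thesis
    using prob_eq_1[OF sets_atoms[of atoms]] by simp
qed

text \<open>The lower bound is stated for an arbitrary set \<open>B\<close> of atoms: taking all atoms bounds the whole sum,
  and taking all atoms but one isolates the contribution of a single atom.\<close>

lemma powr_sum_ge:
  assumes "\<theta> < 1" "B \<subseteq> atoms"
  shows "ennreal (2 powr (1 - \<theta>) * measure \<nu> B) \<le> (\<Sum>\<^sub>\<infinity>\<xi>\<in>B. ennreal (measure \<nu> {\<xi>} powr \<theta>))"
proof -
  have B: "countable B" using assms(2) countable_atoms by (rule countable_subset)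
  have "ennreal (2 powr (1 - \<theta>) * measure \<nu> B) = ennreal (2 powr (1 - \<theta>)) * emeasure \<nu> B"
    by (simp add: emeasure_eq_measure ennreal_mult)
  also have "emeasure \<nu> B = (\<integral>\<^sup>+\<xi>. emeasure \<nu> {\<xi>} \<partial>count_space B)"
    using assms(2) by (intro emeasure_countable_singleton B) (auto simp: atoms_def singleton_sets)
  also have "ennreal (2 powr (1 - \<theta>)) * \<dots>
      = (\<integral>\<^sup>+\<xi>. ennreal (2 powr (1 - \<theta>)) * emeasure \<nu> {\<xi>} \<partial>count_space B)"
    by (rule nn_integral_cmult[symmetric]) simp
  also have "\<dots> \<le> (\<integral>\<^sup>+\<xi>. ennreal (measure \<nu> {\<xi>} powr \<theta>) \<partial>count_space B)"
  proof (rule nn_integral_mono)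
    fix \<xi> assume "\<xi> \<in> space (count_space B)"
    then have "\<xi> \<in> sphere 0 1" "0 < measure \<nu> {\<xi>}"
      using assms(2) by (auto simp: atoms_def zero_less_measure_iff)
    then have "2 powr (1 - \<theta>) * measure \<nu> {\<xi>} \<le> measure \<nu> {\<xi>} powr \<theta>"
      using atom_le_half assms(1) by (intro two_powr_mult_le) auto
    then show "ennreal (2 powr (1 - \<theta>)) * emeasure \<nu> {\<xi>} \<le> ennreal (measure \<nu> {\<xi>} powr \<theta>)"
      by (simp add: emeasure_eq_measure ennreal_mult[symmetric] ennreal_leI)
  qed
  also have "\<dots> = (\<Sum>\<^sub>\<infinity>\<xi>\<in>B. ennreal (measure \<nu> {\<xi>} powr \<theta>))"
    by (rule infsum_ennreal_eq_nn_integral_count_space[OF B, symmetric])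
  finally show ?thesis .
qed

lemma atom_power_sum_eq: "atom_power_sum \<theta> \<nu> = (\<Sum>\<^sub>\<infinity>\<xi>\<in>atoms. ennreal (measure \<nu> {\<xi>} powr \<theta>))"
  by (simp add: atom_power_sum_def atoms_def)

lemma atom_power_sum_ge:
  assumes "\<theta> < 1"
  shows "ennreal (2 powr (1 - \<theta>)) \<le> atom_power_sum \<theta> \<nu>"
  using powr_sum_ge[OF assms order_refl] by (simp add: atom_power_sum_eq measure_atoms)

text \<open>For a minimiser and any atom of mass \<open>t\<close>, bounding the sum over the other atoms by \<open>c (1 - t)\<close>
  with \<open>c = 2\<^sup>1\<^sup>-\<^sup>\<theta>\<close> leaves \<open>t\<^sup>\<theta> \<le> c t\<close>, which forces \<open>t = 1/2\<close>.\<close>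

lemma minimal_imp_atom_half:
  assumes \<theta>: "\<theta> < 1" and min: "atom_power_sum \<theta> \<nu> \<le> ennreal (2 powr (1 - \<theta>))"
  obtains \<xi> where "\<xi> \<in> sphere 0 1" "measure \<nu> {\<xi>} = 1 / 2"
proof -
  have "atoms \<noteq> {}" using measure_atoms by auto
  then obtain \<xi> where \<xi>: "\<xi> \<in> atoms" by blast
  then have \<xi>': "\<xi> \<in> sphere 0 1" "0 < measure \<nu> {\<xi>}"
    by (auto simp: atoms_def zero_less_measure_iff)
  let ?c = "2 powr (1 - \<theta>)" and ?m = "measure \<nu> {\<xi>}"
  have rest: "measure \<nu> (atoms - {\<xi>}) = 1 - ?m"
    using \<xi> sets_atoms by (subst finite_measure_Diff) (auto simp: measure_atoms)
  have "ennreal (?m powr \<theta> + ?c * (1 - ?m)) = ennreal (?m powr \<theta>) + ennreal (?c * (1 - ?m))"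
    by (rule ennreal_plus) (auto simp: prob_le_1)
  also have "\<dots> \<le> ennreal (?m powr \<theta>)
      + (\<Sum>\<^sub>\<infinity>\<eta>\<in>atoms - {\<xi>}. ennreal (measure \<nu> {\<eta>} powr \<theta>))"
    using powr_sum_ge[OF \<theta>, of "atoms - {\<xi>}"] unfolding rest by (intro add_left_mono) auto
  also have "\<dots> = (\<Sum>\<^sub>\<infinity>\<eta>\<in>{\<xi>} \<union> (atoms - {\<xi>}). ennreal (measure \<nu> {\<eta>} powr \<theta>))"
  proof -
    have "(\<Sum>\<^sub>\<infinity>\<eta>\<in>{\<xi>} \<union> (atoms - {\<xi>}). ennreal (measure \<nu> {\<eta>} powr \<theta>))
        = (\<Sum>\<^sub>\<infinity>\<eta>\<in>{\<xi>}. ennreal (measure \<nu> {\<eta>} powr \<theta>))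
          + (\<Sum>\<^sub>\<infinity>\<eta>\<in>atoms - {\<xi>}. ennreal (measure \<nu> {\<eta>} powr \<theta>))"
      by (rule infsum_Un_disjoint) (auto intro: nonneg_summable_on_complete)
    then show ?thesis by simp
  qed
  also have "{\<xi>} \<union> (atoms - {\<xi>}) = atoms" using \<xi> by auto
  also have "(\<Sum>\<^sub>\<infinity>\<eta>\<in>atoms. ennreal (measure \<nu> {\<eta>} powr \<theta>)) \<le> ennreal ?c"
    using min by (simp add: atom_power_sum_eq)
  finally have "?m powr \<theta> \<le> ?c * ?m"
    by (simp add: ennreal_le_iff algebra_simps)
  then have "\<not> ?m < 1 / 2"
    using two_powr_mult_less[OF \<xi>'(2) _ \<theta>] by fastforce
  then show ?thesis
    using that[OF \<xi>'(1)] atom_le_half[OF \<xi>'(1)] by simp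
qed

end

section \<open>Antipodal pairs\<close>

lemma sphere_neq_uminus:
  fixes \<xi> :: "real ^ 'd::finite"
  assumes "\<xi> \<in> sphere 0 1"
  shows "\<xi> \<noteq> - \<xi>"
proof
  assume "\<xi> = - \<xi>"
  then have "\<xi> = 0" by (metis (mono_tags) add_eq_0_iff scaleR_2 scaleR_eq_0_iff zero_neq_numeral)
  with assms show False by simp
qed

text \<open>The uniform probability measure on \<open>{\<xi>, - \<xi>}\<close>.\<close>

definition antipodal_pair :: "real ^ 'd::finite \<Rightarrow> (real ^ 'd) measure" where
  "antipodal_pair \<xi> = add_measure (scale_measure (1 / 2) (dirac \<xi>)) (scale_measure (1 / 2) (dirac (- \<xi>)))"

lemma sets_antipodal_pair: "sets (antipodal_pair \<xi>) = sets sphere_borel"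
  by (simp add: antipodal_pair_def dirac_def)

lemma emeasure_antipodal_pair:
  fixes A :: "(real ^ 'd::finite) set"
  assumes "A \<in> sets sphere_borel"
  shows "emeasure (antipodal_pair \<xi>) A = ennreal (indicator A \<xi> / 2 + indicator A (- \<xi>) / 2)"
proof -
  have half: "1 / 2 * indicator A x = ennreal (indicator A x / 2)" for x :: "real ^ 'd"
    by (simp add: indicator_def divide_ennreal[symmetric])
  show ?thesis
    unfolding antipodal_pair_def
    using assms by (subst emeasure_add_measure) (auto simp: dirac_def half)
qed

lemma measure_antipodal_pair:
  "A \<in> sets sphere_borel \<Longrightarrow> measure (antipodal_pair \<xi>) A = indicator A \<xi> / 2 + indicator A (- \<xi>) / 2"
  by (simp add: measure_def emeasure_antipodal_pair del: ennreal_plus)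

lemma antipodal_pair_in_M_c:
  fixes \<xi> :: "real ^ 'd::finite"
  assumes \<xi>: "\<xi> \<in> sphere 0 1"
  shows "antipodal_pair \<xi> \<in> M_c 1"
proof -
  have sing: "{x} \<in> sets sphere_borel" if "x \<in> sphere 0 1" for x :: "real ^ 'd"
    using that by (simp add: sets_sphere_borel_iff)
  have sp: "space (antipodal_pair \<xi>) = sphere 0 1"
    by (metis sets_eq_imp_space_eq sets_antipodal_pair space_sphere_borel)
  have ne: "\<xi> \<noteq> - \<xi>"
    using \<xi> by (rule sphere_neq_uminus)
  have "sphere 0 1 \<in> sets (sphere_borel :: (real ^ 'd) measure)"
    by (simp add: sets_sphere_borel_iff)
  then have prob: "prob_space (antipodal_pair \<xi>)"
    using \<xi> by (intro prob_spaceI) (simp add: sp emeasure_antipodal_pair)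
  interpret prob_space "antipodal_pair \<xi>" by (rule prob)
  have null: "emeasure (antipodal_pair \<xi>) (sphere 0 1 - {\<xi>, - \<xi>}) = 0"
    by (subst emeasure_antipodal_pair) (auto simp: sets_sphere_borel_iff)
  have ae: "AE x in antipodal_pair \<xi>. x \<notin> sphere 0 1 - {\<xi>, - \<xi>}"
    using null by (intro AE_not_in) (auto simp: null_sets_def sets_antipodal_pair sets_sphere_borel_iff)
  have "(\<integral>x. a \<bullet> x \<partial>antipodal_pair \<xi>) = 0" for a
  proof -
    have "(\<integral>x. a \<bullet> x \<partial>antipodal_pair \<xi>)
        = (\<integral>x. a \<bullet> \<xi> * indicator {\<xi>} x - a \<bullet> \<xi> * indicator {- \<xi>} x \<partial>antipodal_pair \<xi>)"
    proof (rule integral_cong_AE)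
      show "AE x in antipodal_pair \<xi>. a \<bullet> x = a \<bullet> \<xi> * indicator {\<xi>} x - a \<bullet> \<xi> * indicator {- \<xi>} x"
        using ae by (rule AE_mp) (use ne in \<open>auto intro!: AE_I2 simp: sp\<close>)
    qed (rule borel_measurable_sphere[OF sets_antipodal_pair], simp)+
    also have "\<dots> = a \<bullet> \<xi> * measure (antipodal_pair \<xi>) {\<xi>} - a \<bullet> \<xi> * measure (antipodal_pair \<xi>) {- \<xi>}"
      using \<xi> sing[of \<xi>] sing[of "- \<xi>"]
      by (subst Bochner_Integration.integral_diff)
         (auto simp: sp sets_antipodal_pair emeasure_eq_measure)
    also have "\<dots> = 0"
      using \<xi> ne sing[of \<xi>] sing[of "- \<xi>"] by (simp add: measure_antipodal_pair indicator_def)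
    finally show ?thesis .
  qed
  then have "\<forall>f\<in>poly_mean_zero 1. (\<integral>x. f x \<partial>antipodal_pair \<xi>) = 0"
    using poly_mean_zero_1_iff[where 'd='d] by fastforce
  moreover have "\<exists>X. countable X \<and> X \<subseteq> sphere 0 1 \<and> emeasure (antipodal_pair \<xi>) (sphere 0 1 - X) = 0"
    using \<xi> null by (intro exI[of _ "{\<xi>, - \<xi>}"]) auto
  ultimately show ?thesis
    using prob by (simp add: M_c_def sets_antipodal_pair)
qed

lemma atom_power_sum_antipodal_pair:
  fixes \<xi> :: "real ^ 'd::finite"
  assumes \<xi>: "\<xi> \<in> sphere 0 1"
  shows "atom_power_sum \<theta> (antipodal_pair \<xi>) = ennreal (2 powr (1 - \<theta>))"
proof -
  have ne: "\<xi> \<noteq> - \<xi>"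
    using \<xi> by (rule sphere_neq_uminus)
  have m: "measure (antipodal_pair \<xi>) {x} = (if x = \<xi> \<or> x = - \<xi> then 1 / 2 else 0)"
    if "x \<in> sphere 0 1" for x
    using that ne by (subst measure_antipodal_pair) (auto simp: sets_sphere_borel_iff indicator_def)
  have atoms: "{x \<in> sphere 0 1. measure (antipodal_pair \<xi>) {x} \<noteq> 0} = {\<xi>, - \<xi>}"
    using \<xi> by (auto simp: m split: if_splits)
  have "atom_power_sum \<theta> (antipodal_pair \<xi>) = ennreal ((1 / 2) powr \<theta>) + ennreal ((1 / 2) powr \<theta>)"
  proof -
    have "(\<Sum>\<^sub>\<infinity>x\<in>{\<xi>, - \<xi>}. ennreal (measure (antipodal_pair \<xi>) {x} powr \<theta>))
        = (\<Sum>x\<in>{\<xi>, - \<xi>}. ennreal ((1 / 2) powr \<theta>))"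
      unfolding infsum_finite[OF finite.insertI[OF finite.insertI[OF finite.emptyI]]]
      using \<xi> by (intro sum.cong) (auto simp: m)
    also have "\<dots> = ennreal ((1 / 2) powr \<theta>) + ennreal ((1 / 2) powr \<theta>)"
      using ne by (subst sum.insert) auto
    finally show ?thesis
      unfolding atom_power_sum_def atoms .
  qed
  also have "\<dots> = ennreal ((1 / 2) powr \<theta> + (1 / 2) powr \<theta>)"
    by (rule ennreal_plus[symmetric]) auto
  also have "(1 / 2) powr \<theta> + (1 / 2) powr \<theta> = 2 powr (1 - \<theta>)"
    by (simp add: powr_diff powr_divide)
  finally show ?thesis .
qed

lemma (in centred_measure) antipodal_pairI:
  assumes \<xi>: "\<xi> \<in> sphere 0 1" and half: "measure \<nu> {\<xi>} = 1 / 2"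
  shows "\<nu> = antipodal_pair \<xi>"
proof (rule measure_eqI)
  show "sets \<nu> = sets (antipodal_pair \<xi>)"
    by (simp add: sets_eq sets_antipodal_pair)
  have ae: "AE x in \<nu>. x = \<xi> \<or> x = - \<xi>"
    by (rule atom_half_imp_antipodal[OF assms])
  have ne: "\<xi> \<noteq> - \<xi>"
    using \<xi> by (rule sphere_neq_uminus)
  have "measure \<nu> ({\<xi>} \<union> {- \<xi>}) = 1"
    using ae \<xi> singleton_sets[of \<xi>] singleton_sets[of "- \<xi>"]
    by (subst prob_eq_1[OF sets.Un]) auto
  then have half': "measure \<nu> {- \<xi>} = 1 / 2"
    using half \<xi> ne singleton_sets[of \<xi>] singleton_sets[of "- \<xi>"]
    by (subst (asm) finite_measure_Union) auto
  fix A assume A: "A \<in> sets \<nu>"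
  have "emeasure \<nu> A = emeasure \<nu> (A \<inter> {\<xi>} \<union> A \<inter> {- \<xi>})"
    using ae A \<xi> singleton_sets[of \<xi>] singleton_sets[of "- \<xi>"] by (intro emeasure_eq_AE) auto
  also have "\<dots> = ennreal (measure \<nu> (A \<inter> {\<xi>}) + measure \<nu> (A \<inter> {- \<xi>}))"
    using ne A \<xi> singleton_sets[of \<xi>] singleton_sets[of "- \<xi>"]
    unfolding emeasure_eq_measure by (subst finite_measure_Union) auto
  also have "measure \<nu> (A \<inter> {\<xi>}) = indicator A \<xi> / 2"
    using half by (cases "\<xi> \<in> A") auto
  also have "measure \<nu> (A \<inter> {- \<xi>}) = indicator A (- \<xi>) / 2"
    using half' by (cases "- \<xi> \<in> A") auto
  finally show "emeasure \<nu> A = emeasure (antipodal_pair \<xi>) A"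
    using A by (simp add: emeasure_antipodal_pair sets_eq)
qed

theorem proposition3p1:
  fixes n :: nat and \<theta> :: real
  assumes "CARD('d::finite) = n + 1"
    and "0 < \<theta>" and "\<theta> < 1"
  shows "Theta 1 \<theta> TYPE('d) = ennreal (2 powr (1 - \<theta>)) \<and>
    (\<forall>\<nu> :: (real ^ 'd) measure. Theta_achieved_at 1 \<theta> \<nu> \<longleftrightarrow>
       (\<exists>\<xi>\<in>sphere 0 1. \<nu> = add_measure (scale_measure (1 / 2) (dirac \<xi>))
                                     (scale_measure (1 / 2) (dirac (- \<xi>)))))"
proof -
  have centred: "centred_measure \<nu>" if "\<nu> \<in> M_c 1" for \<nu> :: "(real ^ 'd) measure"
    using that by (simp add: centred_measure_def centred_measure_axioms_def M_c_def)
  obtain e :: "real ^ 'd" where e: "e \<in> sphere 0 1"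
    using norm_axis_1 by (metis mem_sphere_0)
  have Theta: "Theta 1 \<theta> TYPE('d) = ennreal (2 powr (1 - \<theta>))"
  proof (rule antisym)
    show "Theta 1 \<theta> TYPE('d) \<le> ennreal (2 powr (1 - \<theta>))"
      unfolding Theta_def atom_power_sum_antipodal_pair[OF e, symmetric]
      by (rule INF_lower[OF antipodal_pair_in_M_c[OF e]])
    show "ennreal (2 powr (1 - \<theta>)) \<le> Theta 1 \<theta> TYPE('d)"
      unfolding Theta_def
      using centred_measure.atom_power_sum_ge[OF centred assms(3)] by (intro INF_greatest)
  qed
  have "Theta_achieved_at 1 \<theta> \<nu> \<longleftrightarrow> (\<exists>\<xi>\<in>sphere 0 1. \<nu> = antipodal_pair \<xi>)"
    for \<nu> :: "(real ^ 'd) measure"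
  proof
    assume "Theta_achieved_at 1 \<theta> \<nu>"
    then have \<nu>: "\<nu> \<in> M_c 1" "atom_power_sum \<theta> \<nu> \<le> ennreal (2 powr (1 - \<theta>))"
      unfolding Theta_achieved_at_def Theta by simp_all
    interpret centred_measure \<nu> by (rule centred[OF \<nu>(1)])
    obtain \<xi> where "\<xi> \<in> sphere 0 1" "measure \<nu> {\<xi>} = 1 / 2"
      using minimal_imp_atom_half[OF assms(3) \<nu>(2)] .
    then show "\<exists>\<xi>\<in>sphere 0 1. \<nu> = antipodal_pair \<xi>"
      using antipodal_pairI by blast
  next
    assume "\<exists>\<xi>\<in>sphere 0 1. \<nu> = antipodal_pair \<xi>"
    then show "Theta_achieved_at 1 \<theta> \<nu>"
      unfolding Theta_achieved_at_def Theta
      using antipodal_pair_in_M_c atom_power_sum_antipodal_pair by blast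
  qed
  with Theta show ?thesis
    by (simp add: antipodal_pair_def)
qed

end
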